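(* Let $G$ be a connected graph of order $n\geq 2$ and $p$ a positive integer. Then $$\gamma_t(M(G+\overline{K_p}))= \begin{cases} p & \text{if } p\geq 2n,\\ \left\lceil\frac{2(n+p)}{3}\right\rceil & \text{if } \frac{n}{2}\le p\le 2n-1. \end{cases}$$
   Context: All graphs are finite and simple. $\overline{K_p}$ denotes the edgeless graph on $p$ vertices. The join $G+H$ of graphs $G,H$ (on disjoint vertex sets) has vertex set $V(G)\cup V(H)$ and edge set $E(G)\cup E(H)\cup\{vw : v\in V(G), w\in V(H)\}$. For a graph $H$ with no isolated vertices, a total dominating set of $H$ is a set $S\subseteq V(H)$ such that every vertex of $H$ has at least one neighbor in $S$; $\gamma_t(H)$ is the minimum cardinality of a total dominating set. The middle graph $M(G)$ of a graph $G$ has vertex set $V(G)\cup E(G)$ (disjoint union), and two of its vertices $x,y$ are adjacent exactly when either $x,y\in E(G)$ are edges of $G$ sharing a common endpoint, or $x\in V(G)$, $y\in E(G)$ and $x$ is an endpoint of $y$ (no two elements of $V(G)$ are adjacent in $M(G)$). *)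

theory Defs
  imports Complex_Main
begin

text \<open>An undirected graph is a pair of a vertex set and a set of edges, each edge being the
  two-element set of its endpoints.\<close>

type_synonym 'a ugraph = "'a set \<times> 'a set set"

abbreviation verts :: "'a ugraph \<Rightarrow> 'a set" where
  "verts \<equiv> fst"

abbreviation edges :: "'a ugraph \<Rightarrow> 'a set set" where
  "edges \<equiv> snd"

definition simple_graph :: "'a ugraph \<Rightarrow> bool" where
  "simple_graph G \<longleftrightarrow> finite (verts G) \<and> (\<forall>e\<in>edges G. e \<subseteq> verts G \<and> card e = 2)"

definition adjacent :: "'a ugraph \<Rightarrow> 'a \<Rightarrow> 'a \<Rightarrow> bool" where
  "adjacent G u v \<longleftrightarrow> {u, v} \<in> edges G"

definition connected_graph :: "'a ugraph \<Rightarrow> bool" where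
  "connected_graph G \<longleftrightarrow>
     verts G \<noteq> {} \<and> (\<forall>u\<in>verts G. \<forall>v\<in>verts G. (adjacent G)\<^sup>*\<^sup>* u v)"

definition no_isolated_vertices :: "'a ugraph \<Rightarrow> bool" where
  "no_isolated_vertices G \<longleftrightarrow> (\<forall>v\<in>verts G. \<exists>u\<in>verts G. adjacent G v u)"

definition edgeless_graph :: "nat \<Rightarrow> nat ugraph" where
  "edgeless_graph p = ({..<p}, {})"

text \<open>The sum type makes the vertex sets of the two graphs disjoint.\<close>

definition join_graph :: "'a ugraph \<Rightarrow> 'b ugraph \<Rightarrow> ('a + 'b) ugraph" where
  "join_graph G H =
     (verts G <+> verts H,
      (\<lambda>e. Inl ` e) ` edges G \<union> (\<lambda>e. Inr ` e) ` edges H \<union>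
      {{Inl v, Inr w} | v w. v \<in> verts G \<and> w \<in> verts H})"

definition middle_graph :: "'a ugraph \<Rightarrow> ('a + 'a set) ugraph" where
  "middle_graph G =
     (verts G <+> edges G,
      {{Inr e, Inr f} | e f. e \<in> edges G \<and> f \<in> edges G \<and> e \<noteq> f \<and> e \<inter> f \<noteq> {}} \<union>
      {{Inl v, Inr e} | v e. v \<in> verts G \<and> e \<in> edges G \<and> v \<in> e})"

definition total_dominating_set :: "'a ugraph \<Rightarrow> 'a set \<Rightarrow> bool" where
  "total_dominating_set H S \<longleftrightarrow> S \<subseteq> verts H \<and> (\<forall>v\<in>verts H. \<exists>u\<in>S. adjacent H v u)"

text \<open>Meaningful only for finite graphs without isolated vertices, since the set of total
  dominating sets must be finite and nonempty.\<close>

definition total_domination_number :: "'a ugraph \<Rightarrow> nat" where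
  "total_domination_number H = Min (card ` {S. total_dominating_set H S})"

lemma simple_graph_edgeless_graph: "simple_graph (edgeless_graph p)"
  by (simp add: simple_graph_def edgeless_graph_def)

lemma simple_graph_join_graph:
  assumes "simple_graph G" and "simple_graph H"
  shows "simple_graph (join_graph G H)"
  using assms unfolding simple_graph_def join_graph_def
  by (auto simp: card_image)

lemma simple_graph_middle_graph:
  assumes "simple_graph G"
  shows "simple_graph (middle_graph G)"
proof -
  have "edges G \<subseteq> Pow (verts G)" "finite (verts G)"
    using assms by (auto simp: simple_graph_def)
  then have "finite (edges G)"
    using finite_subset by blast
  with \<open>finite (verts G)\<close> show ?thesis
    using card_2_iff by (fastforce simp: simple_graph_def middle_graph_def)
qed

lemma no_isolated_vertices_join_graph:
  assumes "verts G \<noteq> {}" and "verts H \<noteq> {}"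
  shows "no_isolated_vertices (join_graph G H)"
  unfolding no_isolated_vertices_def
proof
  fix x assume "x \<in> verts (join_graph G H)"
  then consider v where "x = Inl v" "v \<in> verts G" | w where "x = Inr w" "w \<in> verts H"
    by (auto simp: join_graph_def)
  then show "\<exists>y\<in>verts (join_graph G H). adjacent (join_graph G H) x y"
  proof cases
    case 1
    obtain w where "w \<in> verts H" using assms by blast
    with 1 show ?thesis
      by (intro bexI[of _ "Inr w"]) (auto simp: join_graph_def adjacent_def)
  next
    case 2
    obtain v where "v \<in> verts G" using assms by blast
    moreover have "{Inr w, Inl v} = {Inl v, Inr w :: 'a + 'b}" by blast
    ultimately show ?thesis using 2
      by (intro bexI[of _ "Inl v"]) (auto simp: join_graph_def adjacent_def)
  qed
qed

lemma no_isolated_vertices_middle_graph: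
  assumes "simple_graph G" and "no_isolated_vertices G"
  shows "no_isolated_vertices (middle_graph G)"
  unfolding no_isolated_vertices_def
proof
  fix x assume "x \<in> verts (middle_graph G)"
  then consider v where "x = Inl v" "v \<in> verts G" | e where "x = Inr e" "e \<in> edges G"
    by (auto simp: middle_graph_def)
  then show "\<exists>y\<in>verts (middle_graph G). adjacent (middle_graph G) x y"
  proof cases
    case 1
    then obtain u where "{v, u} \<in> edges G"
      using assms(2) by (auto simp: no_isolated_vertices_def adjacent_def)
    with 1 show ?thesis
      by (intro bexI[of _ "Inr {v, u}"]) (auto simp: middle_graph_def adjacent_def)
  next
    case 2
    then have "e \<noteq> {}" "e \<subseteq> verts G"
      using assms(1) by (auto simp: simple_graph_def)
    then obtain v where "v \<in> e" "v \<in> verts G" by blast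
    moreover have "{Inr e, Inl v} = {Inl v, Inr e}" by blast
    ultimately show ?thesis using 2
      by (intro bexI[of _ "Inl v"]) (auto simp: middle_graph_def adjacent_def)
  qed
qed

lemma total_domination_number_attained:
  assumes "simple_graph H" and "no_isolated_vertices H"
  shows "\<exists>S. total_dominating_set H S \<and> card S = total_domination_number H"
    and "\<And>S. total_dominating_set H S \<Longrightarrow> total_domination_number H \<le> card S"
proof -
  let ?T = "{S. total_dominating_set H S}"
  have "?T \<subseteq> Pow (verts H)" "finite (verts H)"
    using assms(1) by (auto simp: total_dominating_set_def simple_graph_def)
  then have fin: "finite (card ` ?T)"
    by (meson finite_Pow_iff finite_imageI finite_subset)
  have "verts H \<in> ?T"
    using assms(2) by (auto simp: total_dominating_set_def no_isolated_vertices_def)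
  then have "card ` ?T \<noteq> {}" by blast
  from Min_in[OF fin this]
  show "\<exists>S. total_dominating_set H S \<and> card S = total_domination_number H"
    by (auto simp: total_domination_number_def)
  show "total_domination_number H \<le> card S" if "total_dominating_set H S" for S
    using that fin by (auto simp: total_domination_number_def intro: Min_le)
qed

end

theory Submission
  imports Defs
begin

text \<open>A total dominating set of \<open>M(H)\<close> consists of a set \<open>F\<close> of edges that covers every
  vertex of \<open>H\<close> and a set \<open>W\<close> of vertices meeting every isolated edge of \<open>F\<close>. Counting the vertices
  that lie on exactly one edge of \<open>F\<close> gives \<open>2 |V(H)| \<le> 3 |F| + |W|\<close>, and if \<open>H\<close> has an independent
  set of size \<open>p\<close>, then \<open>|F| \<ge> p\<close>. Both bounds are attained in the join by edges of the complete
  bipartite graph between the two sides: cover it by disjoint paths with three vertices, centred on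
  either side, and attach the remaining vertices by one edge each.\<close>

section \<open>Total domination in a middle graph\<close>

lemma adjacent_middle_graph_Inl:
  "adjacent (middle_graph H) (Inl v) u \<longleftrightarrow> (\<exists>e. u = Inr e \<and> v \<in> verts H \<and> e \<in> edges H \<and> v \<in> e)"
  by (auto simp: adjacent_def middle_graph_def doubleton_eq_iff)

lemma adjacent_middle_graph_Inr:
  "adjacent (middle_graph H) (Inr e) u \<longleftrightarrow> e \<in> edges H \<and>
     ((\<exists>f. u = Inr f \<and> f \<in> edges H \<and> f \<noteq> e \<and> e \<inter> f \<noteq> {}) \<or> (\<exists>v. u = Inl v \<and> v \<in> verts H \<and> v \<in> e))"
  by (auto simp: adjacent_def middle_graph_def doubleton_eq_iff)

text \<open>In \<open>middle_graph H\<close> a vertex of \<open>H\<close> sees only its incident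
  edges, while an edge sees its endpoints and the other edges that meet it. So only \<open>F\<close>
  can dominate vertices, and \<open>W\<close> matters only for edges that meet no other edge of
  \<open>F\<close>.\<close>

lemma total_dominating_set_middle_graph_iff:
  "total_dominating_set (middle_graph H) (W <+> F) \<longleftrightarrow>
     W \<subseteq> verts H \<and> F \<subseteq> edges H \<and> (\<forall>v\<in>verts H. \<exists>e\<in>F. v \<in> e) \<and>
     (\<forall>e\<in>edges H. (\<exists>f\<in>F. f \<noteq> e \<and> e \<inter> f \<noteq> {}) \<or> (\<exists>v\<in>W. v \<in> e))"
  (is "?L \<longleftrightarrow> ?R")
proof
  have vM: "verts (middle_graph H) = verts H <+> edges H"
    by (simp add: middle_graph_def)
  show ?R if ?L
  proof (intro conjI ballI)
    show W: "W \<subseteq> verts H" and F: "F \<subseteq> edges H"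
      using that by (auto simp: total_dominating_set_def vM)
    show "\<exists>e\<in>F. v \<in> e" if "v \<in> verts H" for v
    proof -
      have "Inl v \<in> verts (middle_graph H)" using that by (auto simp: vM)
      then obtain u where "u \<in> W <+> F" "adjacent (middle_graph H) (Inl v) u"
        using \<open>?L\<close> unfolding total_dominating_set_def by blast
      then show ?thesis by (auto simp: adjacent_middle_graph_Inl)
    qed
    show "(\<exists>f\<in>F. f \<noteq> e \<and> e \<inter> f \<noteq> {}) \<or> (\<exists>v\<in>W. v \<in> e)" if "e \<in> edges H" for e
    proof -
      have "Inr e \<in> verts (middle_graph H)" using that by (auto simp: vM)
      then obtain u where "u \<in> W <+> F" "adjacent (middle_graph H) (Inr e) u"
        using \<open>?L\<close> unfolding total_dominating_set_def by blast
      then show ?thesis by (auto simp: adjacent_middle_graph_Inr)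
    qed
  qed
  show ?L if R: ?R
    unfolding total_dominating_set_def
  proof (intro conjI ballI)
    show "W <+> F \<subseteq> verts (middle_graph H)" using R by (auto simp: vM)
    fix x assume "x \<in> verts (middle_graph H)"
    then consider v where "x = Inl v" "v \<in> verts H" | e where "x = Inr e" "e \<in> edges H"
      by (auto simp: vM)
    then show "\<exists>u\<in>W <+> F. adjacent (middle_graph H) x u"
    proof cases
      case 1
      then obtain e where "e \<in> F" "v \<in> e" using R by blast
      with 1 R show ?thesis
        by (intro bexI[of _ "Inr e"]) (auto simp: adjacent_middle_graph_Inl)
    next
      case 2
      with R have "(\<exists>f\<in>F. f \<noteq> e \<and> e \<inter> f \<noteq> {}) \<or> (\<exists>v\<in>W. v \<in> e)" by blast
      then show ?thesis
      proof
        assume "\<exists>f\<in>F. f \<noteq> e \<and> e \<inter> f \<noteq> {}"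
        then obtain f where "f \<in> F" "f \<noteq> e" "e \<inter> f \<noteq> {}" by blast
        with 2 R show ?thesis
          by (intro bexI[of _ "Inr f"]) (auto simp: adjacent_middle_graph_Inr)
      next
        assume "\<exists>v\<in>W. v \<in> e"
        then obtain v where "v \<in> W" "v \<in> e" by blast
        with 2 R show ?thesis
          by (intro bexI[of _ "Inl v"]) (auto simp: adjacent_middle_graph_Inr)
      qed
    qed
  qed
qed

lemma Plus_vimage_eq: "S = (Inl -` S) <+> (Inr -` S)"
proof
  show "S \<subseteq> (Inl -` S) <+> (Inr -` S)"
  proof
    fix x assume "x \<in> S"
    then show "x \<in> (Inl -` S) <+> (Inr -` S)" by (cases x) auto
  qed
qed auto

lemma finite_edges:
  assumes "simple_graph H"
  shows "finite (edges H)"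
  using assms finite_subset[of "edges H" "Pow (verts H)"] by (auto simp: simple_graph_def)

lemma total_dominating_set_middle_graphE:
  assumes "simple_graph H" and "total_dominating_set (middle_graph H) S"
  obtains W F where "W \<subseteq> verts H" "F \<subseteq> edges H" "card S = card W + card F"
    "\<And>v. v \<in> verts H \<Longrightarrow> \<exists>e\<in>F. v \<in> e"
    "\<And>e. e \<in> edges H \<Longrightarrow> (\<exists>f\<in>F. f \<noteq> e \<and> e \<inter> f \<noteq> {}) \<or> (\<exists>v\<in>W. v \<in> e)"
proof -
  define W F where "W = Inl -` S" and "F = Inr -` S"
  have S: "S = W <+> F" unfolding W_def F_def by (rule Plus_vimage_eq)
  note props = assms(2)[unfolded S total_dominating_set_middle_graph_iff]
  have "finite W" "finite F"
    using props assms(1) finite_edges[OF assms(1)] finite_subset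
    by (auto simp: simple_graph_def)
  then have "card S = card W + card F" unfolding S by (rule card_Plus)
  with props show ?thesis by (intro that[of W F]) auto
qed

section \<open>Two lower bounds\<close>

text \<open>With \<open>L\<close> the vertices on exactly one edge of \<open>F\<close> and
  \<open>I\<close> the isolated edges of \<open>F\<close>, three estimates are chained:
  \<open>2 * card (verts H)\<close> is at most \<open>2 * card F + card L\<close>,
  \<open>card L\<close> is at most \<open>card F + card I\<close>, and \<open>card I\<close> is at
  most \<open>card W\<close>.\<close>

lemma two_card_verts_le_total_dominating_set_middle_graph:
  assumes H: "simple_graph H" and "total_dominating_set (middle_graph H) S"
  shows "2 * card (verts H) \<le> 3 * card S"
proof -
  obtain W F where WF: "W \<subseteq> verts H" "F \<subseteq> edges H" "card S = card W + card F"
    and cover: "\<And>v. v \<in> verts H \<Longrightarrow> \<exists>e\<in>F. v \<in> e"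
    and dom: "\<And>e. e \<in> edges H \<Longrightarrow> (\<exists>f\<in>F. f \<noteq> e \<and> e \<inter> f \<noteq> {}) \<or> (\<exists>v\<in>W. v \<in> e)"
    using total_dominating_set_middle_graphE[OF assms] by metis
  have finV: "finite (verts H)" using H by (simp add: simple_graph_def)
  have finF: "finite F" using WF(2) finite_edges[OF H] finite_subset by blast
  have finW: "finite W" using WF(1) finV finite_subset by blast
  have eF: "e \<subseteq> verts H" "card e = 2" "finite e" if "e \<in> F" for e
    using that WF(2) H finV by (auto simp: simple_graph_def intro: finite_subset)
  define deg where "deg v = card {e \<in> F. v \<in> e}" for v
  define L where "L = {v \<in> verts H. deg v = 1}"
  define I where "I = {e \<in> F. \<forall>f\<in>F. f \<noteq> e \<longrightarrow> e \<inter> f = {}}"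
  have IF: "I \<subseteq> F" by (auto simp: I_def)
  have finL: "finite L" and LV: "L \<subseteq> verts H" using finV by (auto simp: L_def)
  have deg_pos: "deg v \<ge> 1" if "v \<in> verts H" for v
    using cover[OF that] finF by (auto simp: deg_def Suc_le_eq card_gt_0_iff)
  have "sum deg (verts H) = (\<Sum>e\<in>F. 2)"
    unfolding deg_def
  proof (rule sum_multicount_gen[OF finV finF], intro ballI)
    fix e assume "e \<in> F"
    then have "{v \<in> verts H. v \<in> e} = e" using eF by blast
    then show "card {v \<in> verts H. v \<in> e} = 2" using eF \<open>e \<in> F\<close> by simp
  qed
  then have deg_sum: "sum deg (verts H) = 2 * card F" by simp
  have "2 * card (verts H) = (\<Sum>v\<in>verts H. 2)" by simp
  \<comment> \<open>Covering makes every degree at least 1, so only the vertices of \<open>L\<close>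
    fall short of 2, each by one.\<close>
  also have "\<dots> \<le> (\<Sum>v\<in>verts H. deg v + (if v \<in> L then 1 else 0))"
  proof (rule sum_mono)
    fix v assume "v \<in> verts H"
    with deg_pos[of v] show "2 \<le> deg v + (if v \<in> L then 1 else 0)"
      by (auto simp: L_def)
  qed
  also have "\<dots> = 2 * card F + card L"
    using deg_sum finV LV by (simp add: sum.distrib sum.If_cases Int_absorb1)
  finally have A: "2 * card (verts H) \<le> 2 * card F + card L" .
  \<comment> \<open>Incidences between \<open>L\<close> and \<open>F\<close> are counted twice;
    every degree on \<open>L\<close> is 1, so the left side is \<open>card L\<close>.\<close>
  have "(\<Sum>v\<in>L. deg v) = (\<Sum>e\<in>F. card {v \<in> L. v \<in> e})"
    unfolding deg_def by (rule sum_multicount_gen[OF finL finF]) simp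
  then have "card L = (\<Sum>e\<in>F. card {v \<in> L. v \<in> e})"
    by (simp add: L_def)
  \<comment> \<open>An edge that meets another edge of \<open>F\<close> does so in a vertex of
    degree at least 2, which is outside \<open>L\<close>. Hence only isolated edges can have both
    ends in \<open>L\<close>.\<close>
  also have "\<dots> \<le> (\<Sum>e\<in>F. 1 + (if e \<in> I then 1 else 0))"
  proof (rule sum_mono)
    fix e assume e: "e \<in> F"
    show "card {v \<in> L. v \<in> e} \<le> 1 + (if e \<in> I then 1 else 0)"
    proof (cases "e \<in> I")
      case True
      have "card {v \<in> L. v \<in> e} \<le> card e" using eF[OF e] by (intro card_mono) auto
      with True eF[OF e] show ?thesis by simp
    next
      case False
      then obtain f w where f: "f \<in> F" "f \<noteq> e" "w \<in> e" "w \<in> f"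
        using e by (auto simp: I_def)
      have "card {e, f} \<le> deg w"
        unfolding deg_def using e f finF by (intro card_mono) auto
      then have "w \<notin> L" using f by (auto simp: L_def)
      then have "{v \<in> L. v \<in> e} \<subseteq> e - {w}" by blast
      then have "card {v \<in> L. v \<in> e} \<le> card (e - {w})"
        using eF[OF e] by (intro card_mono) auto
      also have "\<dots> = 1" using eF[OF e] f by simp
      finally show ?thesis by simp
    qed
  qed
  also have "\<dots> = card F + card I"
    using finF IF unfolding sum.distrib by (simp add: sum.If_cases Int_absorb1)
  finally have B: "card L \<le> card F + card I" .
  \<comment> \<open>No edge of \<open>F\<close> dominates an isolated edge, so one of its endpoints
    lies in \<open>W\<close>. Isolated edges are pairwise disjoint, which makes the choice
    \<open>c\<close> injective.\<close>
  have "\<exists>v\<in>W. v \<in> e" if "e \<in> I" for e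
    using dom[of e] that WF(2) by (fastforce simp: I_def)
  then obtain c where c: "\<And>e. e \<in> I \<Longrightarrow> c e \<in> W \<and> c e \<in> e" by metis
  have "inj_on c I"
  proof (rule inj_onI)
    fix e f assume "e \<in> I" "f \<in> I" "c e = c f"
    then have "e \<inter> f \<noteq> {}" using c[of e] c[of f] by auto
    with \<open>e \<in> I\<close> \<open>f \<in> I\<close> show "e = f" unfolding I_def by blast
  qed
  then have "card I \<le> card W"
    using c finW by (intro card_inj_on_le[of c]) auto
  with A B WF(3) show ?thesis by simp
qed

text \<open>Every vertex of \<open>X\<close> is covered by an edge of \<open>F\<close>, and one edge
  cannot cover two vertices of an independent set.\<close>

lemma independent_le_total_dominating_set_middle_graph:
  assumes H: "simple_graph H" and "total_dominating_set (middle_graph H) S"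
    and X: "X \<subseteq> verts H" and indep: "\<And>e x y. e \<in> edges H \<Longrightarrow> x \<in> X \<inter> e \<Longrightarrow> y \<in> X \<inter> e \<Longrightarrow> x = y"
  shows "card X \<le> card S"
proof -
  obtain W F where WF: "W \<subseteq> verts H" "F \<subseteq> edges H" "card S = card W + card F"
    and cover: "\<And>v. v \<in> verts H \<Longrightarrow> \<exists>e\<in>F. v \<in> e"
    using total_dominating_set_middle_graphE[OF assms(1,2)] by metis
  have finF: "finite F" using WF(2) finite_edges[OF H] finite_subset by blast
  obtain g where g: "\<And>v. v \<in> X \<Longrightarrow> g v \<in> F \<and> v \<in> g v"
    using cover X by (metis subsetD)
  have "inj_on g X"
    using g indep WF(2) by (intro inj_onI) (metis IntI subsetD)
  then have "card X \<le> card F" using g finF by (intro card_inj_on_le[of g]) auto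
  with WF(3) show ?thesis by simp
qed

section \<open>Edge covers of complete bipartite graphs without isolated edges\<close>

text \<open>The pair \<open>(i, j)\<close> stands for an edge of the complete bipartite graph with
  sides of sizes \<open>n\<close> and \<open>p\<close>. The last clause excludes isolated edges, so
  that no vertices are needed in the dominating set. As \<open>m\<close> only bounds the size, the
  constructions need not show that the edges they add are new.\<close>

definition bip_cover :: "nat \<Rightarrow> nat \<Rightarrow> nat \<Rightarrow> (nat \<times> nat) set \<Rightarrow> bool" where
  "bip_cover n p m F \<longleftrightarrow> F \<subseteq> {..<n} \<times> {..<p} \<and> card F \<le> m \<and>
     (\<forall>i<n. \<exists>j. (i, j) \<in> F) \<and> (\<forall>j<p. \<exists>i. (i, j) \<in> F) \<and>
     (\<forall>i j. (i, j) \<in> F \<longrightarrow> (\<exists>j'. j' \<noteq> j \<and> (i, j') \<in> F) \<or> (\<exists>i'. i' \<noteq> i \<and> (i', j) \<in> F))"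

text \<open>By this symmetry each extension below has to be built for one side only.\<close>

lemma bip_cover_swap:
  assumes "bip_cover n p m F"
  shows "bip_cover p n m (F\<inverse>)"
proof -
  have "finite F"
    using assms finite_subset[of F "{..<n} \<times> {..<p}"] by (simp add: bip_cover_def)
  then have "card (F\<inverse>) = card F" by (simp add: card_inverse)
  with assms show ?thesis unfolding bip_cover_def converse_iff by auto
qed

text \<open>The new left vertex \<open>n\<close> is the centre of a path whose ends are the new
  right vertices \<open>p\<close> and \<open>Suc p\<close>; its two edges meet in the
  centre.\<close>

lemma bip_cover_add_path:
  assumes "bip_cover n p m F"
  shows "bip_cover (Suc n) (Suc (Suc p)) (m + 2) (insert (n, p) (insert (n, Suc p) F))"
    (is "bip_cover _ _ _ ?F'")
  unfolding bip_cover_def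
proof (intro conjI allI impI)
  show "?F' \<subseteq> {..<Suc n} \<times> {..<Suc (Suc p)}"
    using assms by (force simp: bip_cover_def)
  have "card ?F' \<le> card F + 2"
    using card_insert_le_m1[of "card F + 2" "insert (n, Suc p) F" "(n, p)"]
      card_insert_le_m1[of "card F + 1" F "(n, Suc p)"] by simp
  then show "card ?F' \<le> m + 2" using assms by (simp add: bip_cover_def)
  show "\<exists>j. (i, j) \<in> ?F'" if "i < Suc n" for i
    using that assms by (cases "i = n") (auto simp: bip_cover_def less_Suc_eq)
  show "\<exists>i. (i, j) \<in> ?F'" if "j < Suc (Suc p)" for j
    using that assms by (cases "j < p") (auto simp: bip_cover_def less_Suc_eq)
  show "(\<exists>j'. j' \<noteq> j \<and> (i, j') \<in> ?F') \<or> (\<exists>i'. i' \<noteq> i \<and> (i', j) \<in> ?F')"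
    if "(i, j) \<in> ?F'" for i j
  proof (cases "(i, j) \<in> F")
    case True
    then show ?thesis using assms unfolding bip_cover_def by blast
  next
    case False
    then have "i = n" "j = p \<or> j = Suc p" using that by auto
    then show ?thesis by (intro disjI1 exI[of _ "if j = p then Suc p else p"]) auto
  qed
qed

text \<open>The new left vertex is attached to the right vertex 0. Since \<open>F\<close> already
  covers 0, the new edge meets an old one.\<close>

lemma bip_cover_add_vertex:
  assumes "bip_cover n p m F" and "p > 0"
  shows "bip_cover (Suc n) p (Suc m) (insert (n, 0) F)" (is "bip_cover _ _ _ ?F'")
  unfolding bip_cover_def
proof (intro conjI allI impI)
  show "?F' \<subseteq> {..<Suc n} \<times> {..<p}"
    using assms by (force simp: bip_cover_def)
  have "card ?F' \<le> Suc (card F)"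
    using card_insert_le_m1[of "Suc (card F)" F "(n, 0)"] by simp
  then show "card ?F' \<le> Suc m" using assms by (simp add: bip_cover_def)
  show "\<exists>j. (i, j) \<in> ?F'" if "i < Suc n" for i
    using that assms by (cases "i = n") (auto simp: bip_cover_def less_Suc_eq)
  show "\<exists>i. (i, j) \<in> ?F'" if "j < p" for j
    using that assms unfolding bip_cover_def by blast
  show "(\<exists>j'. j' \<noteq> j \<and> (i, j') \<in> ?F') \<or> (\<exists>i'. i' \<noteq> i \<and> (i', j) \<in> ?F')"
    if "(i, j) \<in> ?F'" for i j
  proof (cases "(i, j) \<in> F")
    case True
    then show ?thesis using assms unfolding bip_cover_def by blast
  next
    case False
    obtain i0 where "(i0, 0) \<in> F" using assms unfolding bip_cover_def by blast
    moreover from this have "i0 \<noteq> n" using assms by (auto simp: bip_cover_def)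
    moreover have "i = n" "j = 0" using that False by auto
    ultimately show ?thesis by blast
  qed
qed

lemma ex_bip_cover_add_path:
  assumes "\<exists>F. bip_cover n p m F"
  shows "\<exists>F. bip_cover (Suc n) (Suc (Suc p)) (m + 2) F"
    and "\<exists>F. bip_cover (Suc (Suc n)) (Suc p) (m + 2) F"
proof -
  obtain F where F: "bip_cover n p m F" using assms by blast
  show "\<exists>F. bip_cover (Suc n) (Suc (Suc p)) (m + 2) F"
    using bip_cover_add_path[OF F] by blast
  show "\<exists>F. bip_cover (Suc (Suc n)) (Suc p) (m + 2) F"
    using bip_cover_swap[OF bip_cover_add_path[OF bip_cover_swap[OF F]]] by blast
qed

lemma ex_bip_cover_add_vertex:
  assumes "\<exists>F. bip_cover n p m F"
  shows "p > 0 \<Longrightarrow> \<exists>F. bip_cover (Suc n) p (Suc m) F"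
    and "n > 0 \<Longrightarrow> \<exists>F. bip_cover n (Suc p) (Suc m) F"
proof -
  obtain F where F: "bip_cover n p m F" using assms by blast
  show "\<exists>F. bip_cover (Suc n) p (Suc m) F" if "p > 0"
    using bip_cover_add_vertex[OF F that] by blast
  show "\<exists>F. bip_cover n (Suc p) (Suc m) F" if "n > 0"
    using bip_cover_swap[OF bip_cover_add_vertex[OF bip_cover_swap[OF F] that]] by blast
qed

text \<open>Here \<open>a\<close> counts the paths centred on the left and \<open>b\<close> those
  centred on the right; each path has two edges.\<close>

lemma ex_bip_cover_paths: "\<exists>F. bip_cover (a + 2 * b) (2 * a + b) (2 * (a + b)) F"
proof (induction a)
  case 0
  show ?case
  proof (induction b)
    case 0
    show ?case by (intro exI[of _ "{}"]) (simp add: bip_cover_def)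
  next
    case (Suc b)
    from ex_bip_cover_add_path(2)[OF this] show ?case by simp
  qed
next
  case (Suc a)
  from ex_bip_cover_add_path(1)[OF this] show ?case by simp
qed

text \<open>Paths centred at all \<open>n\<close> left vertices use \<open>2 * n\<close> right
  vertices; each of the \<open>k\<close> others costs one edge.\<close>

lemma ex_bip_cover_large:
  assumes "n > 0"
  shows "\<exists>F. bip_cover n (2 * n + k) (2 * n + k) F"
proof (induction k)
  case 0
  show ?case using ex_bip_cover_paths[of n 0] by simp
next
  case (Suc k)
  from ex_bip_cover_add_vertex(2)[OF this assms] show ?case by simp
qed

text \<open>The bound is the ceiling of two thirds of \<open>n + p\<close>. Disjoint paths suffice
  if 3 divides \<open>n + p\<close>; otherwise one or two vertices are removed, the rest is covered
  by paths, and each removed vertex is attached by one edge.\<close>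

lemma ex_bip_cover_balanced:
  assumes "n \<le> 2 * p" "p < 2 * n" "n + p \<ge> 3"
  shows "\<exists>F. bip_cover n p ((2 * (n + p) + 2) div 3) F"
proof -
  have base: "\<exists>F. bip_cover n p (2 * k) F"
    if "n \<le> 2 * p" "p \<le> 2 * n" "n + p = 3 * k" for n p k :: nat
  proof -
    \<comment> \<open>This solves \<open>n = a + 2 * b\<close> and \<open>p = 2 * a + b\<close>; the
      two inequalities say that neither subtraction is truncated.\<close>
    define a b where "a = p - k" and "b = n - k"
    have "n = a + 2 * b" "p = 2 * a + b" "a + b = k" using that by (auto simp: a_def b_def)
    with ex_bip_cover_paths[of a b] show ?thesis by simp
  qed
  consider k where "n + p = 3 * k" | k where "n + p = 3 * k + 1" | k where "n + p = 3 * k + 2"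
  proof -
    have "n + p = 3 * ((n + p) div 3) + (n + p) mod 3" by simp
    moreover have "(n + p) mod 3 = 0 \<or> (n + p) mod 3 = 1 \<or> (n + p) mod 3 = 2" by arith
    ultimately show thesis using that by (metis add_0_right)
  qed
  then show ?thesis
  proof cases
    case 1
    then have "(2 * (n + p) + 2) div 3 = 2 * k" by simp
    with base[of n p k] 1 assms show ?thesis by simp
  next
    case 2
    obtain n' where n': "n = Suc n'" using assms by (cases n) auto
    have "p > 0" using assms by simp
    have "n' \<le> 2 * p" "n' + p = 3 * k" using 2 assms n' by simp_all
    \<comment> \<open>The hypothesis alone leaves \<open>p = 2 * n' + 1\<close> open, but then
      \<open>n' + p\<close> would be 1 modulo 3.\<close>
    moreover from this(2) have "p \<le> 2 * n'" using assms(2) n' by presburger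
    ultimately have "\<exists>F. bip_cover n' p (2 * k) F" using base by simp
    moreover have "(2 * (n + p) + 2) div 3 = Suc (2 * k)" using 2 by simp
    ultimately show ?thesis using ex_bip_cover_add_vertex(1)[OF _ \<open>p > 0\<close>] n' by simp
  next
    case 3
    obtain n' p' where n': "n = Suc n'" "p = Suc p'" using assms by (cases n; cases p) auto
    \<comment> \<open>If \<open>p = 1\<close>, then \<open>n \<le> 2\<close>, so
      \<open>n + p = 3 * k + 2\<close> forces \<open>n + p = 2\<close>, contrary to
      \<open>n + p \<ge> 3\<close>.\<close>
    have "p' > 0" using 3 assms n' by arith
    have "p' \<le> 2 * n'" "n' + p' = 3 * k" using 3 assms n' by simp_all
    \<comment> \<open>Again divisibility by 3 rules out the one remaining case
      \<open>n' = 2 * p' + 1\<close>.\<close>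
    moreover from this(2) have "n' \<le> 2 * p'" using assms(1) n' by presburger
    ultimately have "\<exists>F. bip_cover n' p' (2 * k) F" using base by simp
    from ex_bip_cover_add_vertex(2)[OF ex_bip_cover_add_vertex(1)[OF this \<open>p' > 0\<close>]]
    have "\<exists>F. bip_cover n p (Suc (Suc (2 * k))) F" using n' by simp
    moreover have "(2 * (n + p) + 2) div 3 = Suc (Suc (2 * k))" using 3 by simp
    ultimately show ?thesis by simp
  qed
qed

section \<open>From bipartite covers to the join\<close>

text \<open>Numbering the vertices of \<open>G\<close> by \<open>h\<close> turns \<open>F\<close>
  into a set \<open>E\<close> of edges between the two sides of the join. It covers all vertices and
  has no isolated edge, so \<open>E\<close> alone is totally dominating.\<close>

lemma total_domination_number_middle_join_le:
  fixes G :: "'a ugraph"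
  assumes G: "simple_graph G" and n: "card (verts G) = n" and F: "bip_cover n p m F"
    and nz: "n > 0" "p > 0"
  shows "total_domination_number (middle_graph (join_graph G (edgeless_graph p))) \<le> m"
proof -
  let ?H = "join_graph G (edgeless_graph p)"
  have H: "simple_graph ?H"
    using G simple_graph_edgeless_graph by (rule simple_graph_join_graph)
  have "verts G \<noteq> {}" using n nz by auto
  then have iso: "no_isolated_vertices ?H"
    using nz by (intro no_isolated_vertices_join_graph) (auto simp: edgeless_graph_def)
  have "finite (verts G)" using G by (simp add: simple_graph_def)
  from ex_bij_betw_nat_finite[OF this] obtain h where h: "bij_betw h {..<n} (verts G)"
    using n by (auto simp: atLeast0LessThan)
  define E where "E = (\<lambda>(i, j). {Inl (h i), Inr j}) ` F"
  have F_sub: "F \<subseteq> {..<n} \<times> {..<p}" and F_card: "card F \<le> m"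
    using F by (auto simp: bip_cover_def)
  then have "finite F" using finite_subset by fastforce
  have h_in: "h i \<in> verts G" if "i < n" for i using h that by (auto simp: bij_betw_def)
  have h_eq: "h i = h i' \<longleftrightarrow> i = i'" if "i < n" "i' < n" for i i'
    using h that by (auto simp: bij_betw_def inj_on_def)
  have E_sub: "E \<subseteq> edges ?H"
  proof
    fix e assume "e \<in> E"
    then obtain i j where "e = {Inl (h i), Inr j}" "(i, j) \<in> F" by (auto simp: E_def)
    moreover from this have "h i \<in> verts G" "j < p" using F_sub h_in by auto
    ultimately show "e \<in> edges ?H" unfolding join_graph_def edgeless_graph_def by auto
  qed
  have cover: "\<exists>e\<in>E. v \<in> e" if v: "v \<in> verts ?H" for v
  proof -
    from v consider i where "v = Inl (h i)" "i < n" | j where "v = Inr j" "j < p"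
      using bij_betw_imp_surj_on[OF h] by (auto simp: join_graph_def edgeless_graph_def)
    then show ?thesis
    proof cases
      case 1
      then obtain j where "(i, j) \<in> F" using F by (auto simp: bip_cover_def)
      with 1 show ?thesis by (auto simp: E_def)
    next
      case 2
      then obtain i where "(i, j) \<in> F" using F by (auto simp: bip_cover_def)
      with 2 show ?thesis by (force simp: E_def)
    qed
  qed
  have noniso: "\<exists>f\<in>E. f \<noteq> e \<and> e \<inter> f \<noteq> {}" if "e \<in> E" for e
  proof -
    from that obtain i j where e: "e = {Inl (h i), Inr j}" "(i, j) \<in> F" by (auto simp: E_def)
    from F e consider j' where "j' \<noteq> j" "(i, j') \<in> F" | i' where "i' \<noteq> i" "(i', j) \<in> F"
      unfolding bip_cover_def by blast
    then show ?thesis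
    proof cases
      case 1
      then have "{Inl (h i), Inr j'} \<in> E" by (force simp: E_def)
      with 1 e show ?thesis by (intro bexI) (auto simp: doubleton_eq_iff)
    next
      case 2
      then have "h i' \<noteq> h i" using h_eq F_sub e by blast
      moreover have "{Inl (h i'), Inr j} \<in> E" using 2 by (force simp: E_def)
      ultimately show ?thesis using e by (intro bexI) (auto simp: doubleton_eq_iff)
    qed
  qed
  \<comment> \<open>An edge outside \<open>E\<close> meets the edge of \<open>E\<close> that covers
    one of its endpoints, and the two differ.\<close>
  have dom: "\<exists>f\<in>E. f \<noteq> e \<and> e \<inter> f \<noteq> {}" if e: "e \<in> edges ?H" for e
  proof (cases "e \<in> E")
    case False
    have "e \<subseteq> verts ?H" "e \<noteq> {}" using e H by (auto simp: simple_graph_def)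
    then obtain v f where "v \<in> e" "f \<in> E" "v \<in> f" using cover by blast
    with False have "f \<noteq> e" "v \<in> e \<inter> f" by auto
    with \<open>f \<in> E\<close> show ?thesis by (intro bexI[of _ f]) auto
  qed (rule noniso)
  have "total_dominating_set (middle_graph ?H) ({} <+> E)"
    unfolding total_dominating_set_middle_graph_iff
  proof (intro conjI ballI)
    show "E \<subseteq> edges ?H" by (rule E_sub)
    show "\<exists>e\<in>E. v \<in> e" if "v \<in> verts ?H" for v using that by (rule cover)
    show "(\<exists>f\<in>E. f \<noteq> e \<and> e \<inter> f \<noteq> {}) \<or> (\<exists>v\<in>{}. v \<in> e)" if "e \<in> edges ?H" for e
      using dom[OF that] by (rule disjI1)
  qed (rule empty_subsetI)
  from total_domination_number_attained(2)[OF simple_graph_middle_graph[OF H]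
      no_isolated_vertices_middle_graph[OF H iso] this]
  have "total_domination_number (middle_graph ?H) \<le> card E"
    using \<open>finite F\<close> by (simp add: E_def card_Plus)
  also have "\<dots> \<le> card F" unfolding E_def using \<open>finite F\<close> by (rule card_image_le)
  finally show ?thesis using F_card by simp
qed

section \<open>The two ranges of \<open>p\<close>\<close>

theorem theorem4p9:
  fixes G :: "'a ugraph" and n p :: nat
  assumes "simple_graph G"
    and "connected_graph G"
    and "card (verts G) = n"
    and "n \<ge> 2"
    and "p > 0"
  shows "(p \<ge> 2 * n \<longrightarrow>
            total_domination_number (middle_graph (join_graph G (edgeless_graph p))) = p) \<and>
         (real n / 2 \<le> real p \<and> p \<le> 2 * n - 1 \<longrightarrow>
            int (total_domination_number (middle_graph (join_graph G (edgeless_graph p))))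
              = \<lceil>2 * (real n + real p) / 3\<rceil>)"
proof -
  let ?H = "join_graph G (edgeless_graph p)"
  let ?t = "total_domination_number (middle_graph ?H)"
  have H: "simple_graph ?H"
    using assms(1) simple_graph_edgeless_graph by (rule simple_graph_join_graph)
  have "verts G \<noteq> {}" using assms by auto
  then have iso: "no_isolated_vertices ?H"
    using assms by (intro no_isolated_vertices_join_graph) (auto simp: edgeless_graph_def)
  obtain S where S: "total_dominating_set (middle_graph ?H) S" "card S = ?t"
    using total_domination_number_attained(1)[OF simple_graph_middle_graph[OF H]
        no_isolated_vertices_middle_graph[OF H iso]] by blast
  have "card (verts ?H) = n + p"
    using assms by (simp add: join_graph_def edgeless_graph_def card_Plus simple_graph_def)
  then have lower1: "2 * (n + p) \<le> 3 * ?t"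
    using two_card_verts_le_total_dominating_set_middle_graph[OF H S(1)] S(2) by simp
  \<comment> \<open>The \<open>p\<close> vertices of the edgeless side remain independent in the
    join.\<close>
  have "card (Inr ` {..<p} :: ('a + nat) set) \<le> card S"
    by (rule independent_le_total_dominating_set_middle_graph[OF H S(1)])
      (auto simp: join_graph_def edgeless_graph_def)
  then have lower2: "p \<le> ?t" using S(2) by (simp add: card_image)
  have upper: "?t \<le> m" if "\<exists>F. bip_cover n p m F" for m
    using that total_domination_number_middle_join_le assms by fastforce
  show ?thesis
  proof (intro conjI impI)
    assume "p \<ge> 2 * n"
    then have "\<exists>F. bip_cover n p p F"
      using ex_bip_cover_large[of n "p - 2 * n"] assms by simp
    from upper[OF this] lower2 show "?t = p" by simp
  next
    assume "real n / 2 \<le> real p \<and> p \<le> 2 * n - 1"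
    then have "n \<le> 2 * p" "p < 2 * n" "n + p \<ge> 3" using assms by auto
    then have "\<exists>F. bip_cover n p ((2 * (n + p) + 2) div 3) F" by (rule ex_bip_cover_balanced)
    \<comment> \<open>Rounding down in \<open>div\<close> gives
      \<open>3 * ?t \<le> 2 * (n + p) + 2\<close>. Together with \<open>lower1\<close> this places
      \<open>?t\<close> in the half-open unit interval that characterises the ceiling.\<close>
    from upper[OF this] have "3 * ?t < 2 * (n + p) + 3" by linarith
    then have "real (3 * ?t) < real (2 * (n + p) + 3)" by (simp only: of_nat_less_iff)
    moreover have "real (2 * (n + p)) \<le> real (3 * ?t)" using lower1 by (simp only: of_nat_le_iff)
    ultimately show "int ?t = \<lceil>2 * (real n + real p) / 3\<rceil>"
      by (intro ceiling_unique[symmetric]) auto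
  qed
qed

end
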